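(* Let $S=\{x_1,x_2,\dots,x_n\}$ be a GCUD-closed set of $n$ distinct positive integers and let $f$ be a completely multiplicative function with $f(x)\ne 0$ for all positive integers $x$. Then $[S^{\ast\ast}]_f$ is positive definite if and only if $B^{\ast}_{1/f}(x_i)>0$ for all $i=1,2,\ldots,n$.
   Context: An arithmetical function is a complex-valued function on the positive integers. It is completely multiplicative if $f(1)=1$ and $f(ab)=f(a)f(b)$ for all positive integers $a,b$. A positive divisor $d$ of a positive integer $n$ is a unitary divisor of $n$, written $d\parallel n$, if $\gcd(d,n/d)=1$; $d\nparallel n$ means that $d$ is not a unitary divisor of $n$. For positive integers $a,b$, $(a,b)^{\ast\ast}$ denotes the greatest common unitary divisor (GCUD) of $a$ and $b$ (the largest $d$ with $d\parallel a$ and $d\parallel b$), and $[a,b]^{\ast\ast}=ab/(a,b)^{\ast\ast}$. $S$ is GCUD-closed if $(a,b)^{\ast\ast}\in S$ for all $a,b\in S$. $[S^{\ast\ast}]_f$ is the $n\times n$ matrix with $ij$ entry $f([x_i,x_j]^{\ast\ast})$. A matrix is positive definite if it is Hermitian and all its eigenvalues are positive. $\mu^{\ast}$ is the multiplicative function with $\mu^{\ast}(q^k)=-1$ for all prime powers $q^k$, $k\ge 1$ (the unitary analog of the Möbius function). The unitary convolution is $(g\oplus h)(n)=\sum_{d\parallel n}g(d)h(n/d)$. For an arithmetical function $g$, $$B_g^{\ast}(x_i)=\sum_{\substack{d\parallel x_i\\ d\nparallel x_t\text{ for all }x_t\in S\text{ with }x_t<x_i}}(g\oplus\mu^{\ast})(d).$$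 Here $B^{\ast}_{1/f}$ is this quantity for $g=1/f$, i.e. $g(x)=1/f(x)$. *)

theory Defs
  imports
    "HOL-Computational_Algebra.Primes"
    "Jordan_Normal_Form.Char_Poly"
    "Jordan_Normal_Form.Schur_Decomposition"
begin

text \<open>
  Arithmetical functions are modelled by the type \<open>nat \<Rightarrow> complex\<close>. Their value at \<open>0\<close> is
  irrelevant: every notion below only inspects positive arguments.
\<close>

definition completely_multiplicative :: "(nat \<Rightarrow> complex) \<Rightarrow> bool" where
  "completely_multiplicative f \<longleftrightarrow>
     f 1 = 1 \<and> (\<forall>a>0. \<forall>b>0. f (a * b) = f a * f b)"

definition multiplicative :: "(nat \<Rightarrow> complex) \<Rightarrow> bool" where
  "multiplicative f \<longleftrightarrow>
     f 1 = 1 \<and> (\<forall>a>0. \<forall>b>0. coprime a b \<longrightarrow> f (a * b) = f a * f b)"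

definition unitary_dvd :: "nat \<Rightarrow> nat \<Rightarrow> bool" (infix "udvd" 50) where
  "d udvd n \<longleftrightarrow> n > 0 \<and> d dvd n \<and> gcd d (n div d) = 1"

definition gcud :: "nat \<Rightarrow> nat \<Rightarrow> nat" where
  "gcud a b = Max {d. d udvd a \<and> d udvd b}"

text \<open>\<open>ab/(a,b)\<^sup>*\<^sup>*\<close>; the division is exact, see \<open>gcud_dvd\<close> below.\<close>

definition lcum :: "nat \<Rightarrow> nat \<Rightarrow> nat" where
  "lcum a b = a * b div gcud a b"

definition gcud_closed :: "nat set \<Rightarrow> bool" where
  "gcud_closed S \<longleftrightarrow> (\<forall>a\<in>S. \<forall>b\<in>S. gcud a b \<in> S)"

definition unitary_conv :: "(nat \<Rightarrow> complex) \<Rightarrow> (nat \<Rightarrow> complex) \<Rightarrow> nat \<Rightarrow> complex" where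
  "unitary_conv g h n = (\<Sum>d | d udvd n. g d * h (n div d))"

text \<open>
  The multiplicative function with value \<open>-1\<close> at every prime power \<open>q\<^sup>k\<close>, \<open>k \<ge> 1\<close>, in closed form.
  Lemmas \<open>multiplicative_mu_star\<close>, \<open>mu_star_prime_power\<close> and \<open>mu_star_unique\<close> show that it
  is the only function on the positive integers with these properties.
\<close>

definition mu_star :: "nat \<Rightarrow> complex" where
  "mu_star n = (\<Prod>p\<in>prime_factors n. - 1)"

definition B_star :: "(nat \<Rightarrow> complex) \<Rightarrow> nat set \<Rightarrow> nat \<Rightarrow> complex" where
  "B_star g S y =
     (\<Sum>d | d udvd y \<and> (\<forall>z\<in>S. z < y \<longrightarrow> \<not> d udvd z). unitary_conv g mu_star d)"

text \<open>
  The \<open>n \<times> n\<close> matrix with \<open>ij\<close> entry \<open>f [x\<^sub>i, x\<^sub>j]\<^sup>*\<^sup>*\<close>; indices run over \<open>0, \<dots>, n - 1\<close>.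
\<close>

definition lcum_mat :: "(nat \<Rightarrow> complex) \<Rightarrow> nat \<Rightarrow> (nat \<Rightarrow> nat) \<Rightarrow> complex mat" where
  "lcum_mat f n x = mat n n (\<lambda>(i, j). f (lcum (x i) (x j)))"

text \<open>
  The order on \<^typ>\<open>complex\<close> is the one of \<^theory>\<open>HOL-Library.Complex_Order\<close>: \<open>0 < k\<close> means that
  \<open>k\<close> is real and positive.
\<close>

definition positive_definite :: "complex mat \<Rightarrow> bool" where
  "positive_definite A \<longleftrightarrow>
     square_mat A \<and> mat_adjoint A = A \<and> (\<forall>k. eigenvalue A k \<longrightarrow> 0 < k)"

lemma finite_udvd: "finite {d. d udvd n}"
proof (cases "n = 0")
  case False
  then show ?thesis
    by (intro finite_subset[OF _ finite_divisors_nat[of n]]) (auto simp: unitary_dvd_def)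
qed (simp add: unitary_dvd_def)

lemma
  assumes "a > 0" "b > 0"
  shows gcud_udvd1: "gcud a b udvd a" and gcud_udvd2: "gcud a b udvd b"
proof -
  have "finite {d. d udvd a \<and> d udvd b}"
    by (rule finite_subset[OF _ finite_udvd[of a]]) auto
  moreover have "1 \<in> {d. d udvd a \<and> d udvd b}"
    using assms by (simp add: unitary_dvd_def)
  ultimately have "gcud a b \<in> {d. d udvd a \<and> d udvd b}"
    unfolding gcud_def by (intro Max_in) blast+
  then show "gcud a b udvd a" "gcud a b udvd b" by auto
qed

lemma gcud_dvd: "a > 0 \<Longrightarrow> b > 0 \<Longrightarrow> gcud a b dvd a * b"
  using gcud_udvd1[of a b] by (simp add: unitary_dvd_def)

lemma multiplicative_mu_star: "multiplicative mu_star"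
proof -
  have "mu_star (a * b) = mu_star a * mu_star b" if "a > 0" "b > 0" "coprime a b" for a b
  proof -
    have "prime_factors a \<inter> prime_factors b = {}"
      using \<open>coprime a b\<close> by (auto simp: in_prime_factors_iff dest: coprime_common_divisor)
    moreover have "prime_factors (a * b) = prime_factors a \<union> prime_factors b"
      using that by (simp add: prime_factors_product)
    ultimately show ?thesis
      unfolding mu_star_def by (simp add: prod.union_disjoint del: prod_constant)
  qed
  moreover have "mu_star 1 = 1" by (simp add: mu_star_def)
  ultimately show ?thesis by (simp add: multiplicative_def)
qed

lemma mu_star_prime_power: "prime q \<Longrightarrow> k \<ge> 1 \<Longrightarrow> mu_star (q ^ k) = - 1"
  by (simp add: mu_star_def prime_factorization_prime_power)

lemma mu_star_unique:
  assumes "multiplicative g" and "\<And>q k. prime q \<Longrightarrow> k \<ge> 1 \<Longrightarrow> g (q ^ k) = - 1" and "n > 0"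
  shows "g n = mu_star n"
  using \<open>n > 0\<close>
proof (induction n rule: less_induct)
  case (less n)
  show ?case
  proof (cases "n = 1")
    case True
    then show ?thesis
      using assms(1) multiplicative_mu_star by (simp add: multiplicative_def)
  next
    case False
    then obtain p where p: "prime p" "p dvd n" using prime_factor_nat by blast
    define k where "k = multiplicity p n"
    obtain m where m: "n = p ^ k * m" "\<not> p dvd m"
      using multiplicity_decompose'[of n p] less.prems p(1) unfolding k_def
      by (metis not_prime_unit not_gr_zero)
    have k: "k \<ge> 1"
      using m p(2) by (cases k) auto
    have cop: "coprime (p ^ k) m"
      using m(2) p(1) k by (simp add: prime_imp_coprime)
    have pos: "p ^ k > 0" "m > 0" using m(1) less.prems by (auto intro: Nat.gr0I)
    have "p ^ k > 1" using k p(1) by (metis One_nat_def one_less_power prime_gt_1_nat not_less_eq_eq not_gr_zero less_one le_zero_eq)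
    then have "m < n" using m(1) pos by simp
    then have "g m = mu_star m" using less.IH pos by blast
    then show ?thesis
      using assms(1,2) multiplicative_mu_star mu_star_prime_power[OF p(1) k] p(1) k cop pos
      unfolding m(1) multiplicative_def by metis
  qed
qed

end

theory Submission
  imports Defs
begin

text \<open>
  Write \<open>g = 1 / f\<close> and \<open>B k = B_star g S (x k)\<close>. As \<open>lcum a b * gcud a b = a * b\<close>, complete
  multiplicativity gives \<open>f (lcum a b) = f a * f b * g (gcud a b)\<close>. Unitary Moebius inversion, with
  the unitary divisors grouped by the least element of \<open>S\<close> in which they occur, gives
  \<open>g a = (\<Sum>z | z \<in> S \<and> z udvd a. B_star g S z)\<close> for \<open>a \<in> S\<close> (\<open>sum_B_star_udvd\<close>); the grouping
  works because \<open>S\<close> is closed under \<open>gcud\<close>. The unitary divisors of \<open>gcud a b\<close> are the common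
  unitary divisors of \<open>a\<close> and \<open>b\<close> (\<open>udvd_gcud_iff\<close>). Hence the matrix factors as
  \<open>C\<^sup>T D C\<close>, where \<open>D\<close> is diagonal with entries \<open>B k\<close>, and \<open>C\<close> has the entry \<open>f (x j)\<close> at
  \<open>(k, j)\<close> if \<open>x k udvd x j\<close>, and \<open>0\<close> otherwise. Ordering \<open>S\<close> by size makes \<open>C\<close> triangular with
  nonzero diagonal, so \<open>C\<close> is invertible.

  If \<open>f\<close> is real on \<open>S\<close>, then \<open>C\<^sup>T\<close> is the adjoint of \<open>C\<close>, and \<open>C\<^sup>* D C\<close> is positive definite
  exactly when all entries of \<open>D\<close> are positive (\<open>positive_definite_congruent_diagonal_iff\<close>). Both
  sides of the theorem force \<open>f\<close> to be real on \<open>S\<close>: a Hermitian matrix has a real diagonal, which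
  here consists of the values \<open>f (x i)\<close>, while positive \<open>B k\<close> have the real sums \<open>1 / f (x i)\<close>.

  Positive definiteness is given by eigenvalues, but congruence preserves the Hermitian form. The
  bridge is \<open>positive_form_if_positive_definite\<close>: a Hermitian matrix with positive eigenvalues has
  a positive form.
\<close>

section \<open>Unitary divisors and unitary Moebius inversion\<close>

lemma udvd_iff_factor: "d udvd n \<longleftrightarrow> n > 0 \<and> (\<exists>k. n = d * k \<and> coprime d k)"
  unfolding unitary_dvd_def
  by (metis coprime_iff_gcd_eq_1 dvd_def dvd_mult_div_cancel mult_eq_0_iff nonzero_mult_div_cancel_left not_gr_zero)

lemma udvd_trans:
  assumes "a udvd b" "b udvd c"
  shows "a udvd c"
proof -
  from assms obtain k l where "b = a * k" "coprime a k" "c = b * l" "coprime b l" "c > 0"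
    by (auto simp: udvd_iff_factor)
  then show ?thesis
    by (auto simp: udvd_iff_factor intro!: exI[of _ "k * l"])
qed

lemma udvd_refl: "n > 0 \<Longrightarrow> n udvd n"
  by (simp add: udvd_iff_factor)

lemma udvd_imp_le: "d udvd n \<Longrightarrow> d \<le> n"
  by (auto simp: unitary_dvd_def intro: dvd_imp_le)

lemma udvd_pos: "d udvd n \<Longrightarrow> 0 < d"
  by (auto simp: unitary_dvd_def intro: dvd_pos_nat)

text \<open>
  The cofactor of \<open>lcm d e\<close> in \<open>n\<close> divides both \<open>n div d\<close> and \<open>n div e\<close>, so it is coprime to \<open>d * e\<close>.
\<close>

lemma lcm_udvd:
  assumes "d udvd n" "e udvd n"
  shows "lcm d e udvd n"
proof -
  let ?k = "n div lcm d e"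
  have dvd: "lcm d e dvd n" and n: "n > 0"
    using assms by (auto simp: unitary_dvd_def)
  have "?k dvd n div c" if "c dvd lcm d e" for c
  proof -
    obtain l where "lcm d e = c * l" using \<open>c dvd lcm d e\<close> by (rule dvdE)
    moreover obtain m where "n = lcm d e * m" using dvd by (rule dvdE)
    ultimately show ?thesis using n by simp
  qed
  then have "?k dvd n div d" "?k dvd n div e" by auto
  then have "coprime d ?k" "coprime e ?k"
    using assms coprime_divisors[OF dvd_refl, of ?k]
    unfolding unitary_dvd_def coprime_iff_gcd_eq_1[symmetric] by blast+
  then have "coprime (lcm d e) ?k"
    using coprime_divisors[OF _ dvd_refl, of "lcm d e" "d * e" ?k]
    by auto
  then show ?thesis
    using dvd n by (simp add: unitary_dvd_def coprime_iff_gcd_eq_1)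
qed

text \<open>
  The common unitary divisors are closed under \<open>lcm\<close>, so the largest one is a multiple of all the
  others. This upgrades maximality in the order \<open>\<le>\<close> to maximality in the order \<open>udvd\<close>.
\<close>

lemma udvd_gcud_iff:
  assumes "a > 0" "b > 0"
  shows "d udvd gcud a b \<longleftrightarrow> d udvd a \<and> d udvd b"
proof
  assume "d udvd gcud a b"
  then show "d udvd a \<and> d udvd b"
    using gcud_udvd1[OF assms] gcud_udvd2[OF assms] udvd_trans by blast
next
  assume d: "d udvd a \<and> d udvd b"
  let ?g = "gcud a b"
  have g: "?g udvd a" "?g udvd b"
    using gcud_udvd1[OF assms] gcud_udvd2[OF assms] by auto
  have "lcm d ?g \<le> ?g"
    unfolding gcud_def[of a b]
  proof (rule Max_ge)
    show "finite {d. d udvd a \<and> d udvd b}"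
      by (rule finite_subset[OF _ finite_udvd[of a]]) auto
  qed (use d g in \<open>auto simp flip: gcud_def intro: lcm_udvd\<close>)
  moreover have "?g > 0" "d > 0" using d g udvd_pos by auto
  ultimately have "d dvd ?g"
    by (metis dvd_lcm1 dvd_lcm2 dvd_imp_le lcm_pos_nat le_antisym)
  moreover obtain k where k: "a = d * k" "coprime d k"
    using d by (auto simp: udvd_iff_factor)
  ultimately obtain l where l: "?g = d * l" by auto
  with g(1) k \<open>d > 0\<close> have "l dvd k" by (auto simp: unitary_dvd_def)
  then have "coprime d l" using k(2) coprime_divisors[OF dvd_refl] by blast
  then show "d udvd ?g" using l \<open>?g > 0\<close> by (auto simp: udvd_iff_factor)
qed

text \<open>
  A unitary divisor of a number contains each of its prime powers either completely or not at all.
\<close>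

lemma udvd_prime_power_mult:
  assumes p: "prime p" and m: "m > 0" and pm: "\<not> p dvd m"
  shows "{d. d udvd p ^ k * m} = {d. d udvd m} \<union> (*) (p ^ k) ` {d. d udvd m}"
proof (intro equalityI subsetI)
  fix d assume "d \<in> {d. d udvd p ^ k * m}"
  then obtain c where c: "p ^ k * m = d * c" "coprime d c"
    by (auto simp: udvd_iff_factor)
  show "d \<in> {d. d udvd m} \<union> (*) (p ^ k) ` {d. d udvd m}"
  proof (cases "p dvd d")
    case True
    then have "\<not> p dvd c"
      using c(2) p by (meson coprime_common_divisor not_prime_unit)
    then have "coprime (p ^ k) c" using p by (simp add: prime_imp_coprime)
    moreover have "p ^ k dvd d * c" using c(1) by (metis dvd_triv_left)
    ultimately obtain e where e: "d = p ^ k * e"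
      by (auto simp: coprime_dvd_mult_left_iff)
    then have "m = e * c" using c(1) p by (simp add: prime_gt_0_nat)
    moreover have "coprime e c" using c(2) e by simp
    ultimately show ?thesis using m e by (auto simp: udvd_iff_factor)
  next
    case False
    then have "coprime d (p ^ k)"
      using p prime_imp_coprime[of p d] by (simp add: coprime_commute)
    moreover have "d dvd p ^ k * m" using c(1) by simp
    ultimately obtain e where e: "m = d * e"
      by (auto simp: coprime_dvd_mult_right_iff)
    then have "c = p ^ k * e" using c(1) m by simp
    then show ?thesis using c(2) e m by (auto simp: udvd_iff_factor)
  qed
next
  fix d assume "d \<in> {d. d udvd m} \<union> (*) (p ^ k) ` {d. d udvd m}"
  moreover have "coprime (p ^ k) m" using p pm by (simp add: prime_imp_coprime)
  ultimately show "d \<in> {d. d udvd p ^ k * m}"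
    using m p by (auto simp: udvd_iff_factor prime_gt_0_nat coprime_commute
        intro: exI[of _ "p ^ k * _"])
qed

text \<open>
  For \<open>n = p ^ k * m\<close> with \<open>p\<close> not dividing \<open>m\<close>, the terms of \<open>d\<close> and \<open>p ^ k * d\<close> cancel, where \<open>d\<close>
  runs over the unitary divisors of \<open>m\<close>.
\<close>

lemma sum_mu_star_udvd:
  assumes "n > 0"
  shows "(\<Sum>d | d udvd n. mu_star d) = (if n = 1 then 1 else 0)"
proof (cases "n = 1")
  case True
  have "{d. d udvd 1} = {1}" by (auto simp: unitary_dvd_def)
  then show ?thesis using True by (simp add: mu_star_def)
next
  case False
  then obtain p where p: "prime p" "p dvd n" using prime_factor_nat by blast
  define k where "k = multiplicity p n"
  obtain m where m: "n = p ^ k * m" "\<not> p dvd m"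
    using multiplicity_decompose'[of n p] assms p(1) unfolding k_def
    by (metis not_prime_unit not_gr_zero)
  have k: "k \<ge> 1" using m p(2) by (cases k) auto
  have m0: "m > 0" using m(1) assms by auto
  have cop: "\<not> p dvd d" if "d udvd m" for d
    using that m(2) by (auto simp: unitary_dvd_def dest: dvd_trans)
  have mu: "mu_star (p ^ k * d) = - mu_star d" if "d udvd m" for d
  proof -
    have "coprime (p ^ k) d" using cop[OF that] p(1) by (simp add: prime_imp_coprime)
    then show ?thesis
      using multiplicative_mu_star udvd_pos[OF that] p(1) mu_star_prime_power[OF p(1) k]
      by (simp add: multiplicative_def prime_gt_0_nat)
  qed
  have "{d. d udvd m} \<inter> (*) (p ^ k) ` {d. d udvd m} = {}"
    using cop k by (auto simp: dvd_power dvd_mult2 dest!: cop)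
  then have "(\<Sum>d | d udvd n. mu_star d) =
      (\<Sum>d | d udvd m. mu_star d) + (\<Sum>d\<in>(*) (p ^ k) ` {d. d udvd m}. mu_star d)"
    unfolding m(1) udvd_prime_power_mult[OF p(1) m0 m(2)]
    by (intro sum.union_disjoint) (auto simp: finite_udvd)
  also have "(\<Sum>d\<in>(*) (p ^ k) ` {d. d udvd m}. mu_star d) = (\<Sum>d | d udvd m. mu_star (p ^ k * d))"
    using p(1) by (subst sum.reindex) (auto simp: inj_on_def prime_gt_0_nat)
  also have "\<dots> = (\<Sum>d | d udvd m. - mu_star d)"
    using mu by (intro sum.cong) auto
  finally show ?thesis using False by (simp add: sum_negf)
qed

text \<open>
  Unitary Moebius inversion: associativity of the unitary convolution, together with the previous
  lemma, turns \<open>(g \<oplus> \<mu>\<^sup>*) \<oplus> 1\<close> into \<open>g \<oplus> (\<mu>\<^sup>* \<oplus> 1) = g\<close>.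
\<close>

lemma sum_unitary_conv_mu_star:
  assumes n: "n > 0"
  shows "(\<Sum>d | d udvd n. unitary_conv g mu_star d) = g n"
proof -
  have "(\<Sum>d | d udvd n. unitary_conv g mu_star d) =
      (\<Sum>(d, e) \<in> (SIGMA d:{d. d udvd n}. {e. e udvd d}). g e * mu_star (d div e))"
    unfolding unitary_conv_def by (rule sum.Sigma) (auto simp: finite_udvd)
  \<comment> \<open>A chain \<open>e udvd d udvd n\<close> amounts to a splitting \<open>d = e * k\<close> with \<open>k\<close> a unitary divisor of
    the cofactor of \<open>e\<close>.\<close>
  also have "\<dots> = (\<Sum>(e, k) \<in> (SIGMA e:{e. e udvd n}. {k. k udvd n div e}). g e * mu_star k)"
  proof (rule sum.reindex_bij_witness[of _ "\<lambda>(e, k). (e * k, e)" "\<lambda>(d, e). (e, d div e)"])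
    fix a assume "a \<in> (SIGMA d:{d. d udvd n}. {e. e udvd d})"
    then obtain d e where a: "a = (d, e)" "d udvd n" "e udvd d" by auto
    obtain k where k: "d = e * k" "coprime e k" using a by (auto simp: udvd_iff_factor)
    obtain l where l: "n = d * l" "coprime d l" using a by (auto simp: udvd_iff_factor)
    have "k udvd k * l" using k l n by (auto simp: udvd_iff_factor)
    moreover have "e > 0" using n k l by auto
    moreover from this have "n div e = k * l" using k l by simp
    ultimately show "(case a of (d, e) \<Rightarrow> (e, d div e)) \<in> (SIGMA e:{e. e udvd n}. {k. k udvd n div e})"
      using a k udvd_trans by auto
    show "(case (case a of (d, e) \<Rightarrow> (e, d div e)) of (e, k) \<Rightarrow> (e * k, e)) = a"
      using a k by simp
    show "(case case a of (d, e) \<Rightarrow> (e, d div e) of (e, k) \<Rightarrow> g e * mu_star k) =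
         (case a of (d, e) \<Rightarrow> g e * mu_star (d div e))" using a by simp
  next
    fix b assume "b \<in> (SIGMA e:{e. e udvd n}. {k. k udvd n div e})"
    then obtain e k where b: "b = (e, k)" "e udvd n" "k udvd n div e" by auto
    obtain m where m: "n = e * m" "coprime e m" using b by (auto simp: udvd_iff_factor)
    have e: "e > 0" using m n by auto
    then have "k udvd m" using b m by simp
    then obtain l where l: "m = k * l" "coprime k l" by (auto simp: udvd_iff_factor)
    have "e * k udvd n" "e udvd e * k" using m l n
      by (auto simp: udvd_iff_factor)
    then show "(case b of (e, k) \<Rightarrow> (e * k, e)) \<in> (SIGMA d:{d. d udvd n}. {e. e udvd d})"
      using b by simp
    show "(case (case b of (e, k) \<Rightarrow> (e * k, e)) of (d, e) \<Rightarrow> (e, d div e)) = b"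
      using b e by simp
  qed
  also have "\<dots> = (\<Sum>e | e udvd n. g e * (\<Sum>k | k udvd n div e. mu_star k))"
    by (subst sum.Sigma[symmetric]) (auto simp: finite_udvd sum_distrib_left)
  also have "\<dots> = (\<Sum>e | e udvd n. if e = n then g e else 0)"
  proof (rule sum.cong[OF refl])
    fix e assume "e \<in> {e. e udvd n}"
    then obtain m where m: "n = e * m" by (auto simp: udvd_iff_factor)
    then have "n div e = m" "m > 0" "e = n \<longleftrightarrow> m = 1" using n by auto
    then show "g e * (\<Sum>k | k udvd n div e. mu_star k) = (if e = n then g e else 0)"
      by (simp add: sum_mu_star_udvd)
  qed
  also have "\<dots> = g n"
    using n by (simp add: sum.delta' finite_udvd udvd_refl)
  finally show ?thesis .
qed

text \<open>
  Sort the unitary divisors \<open>d\<close> of \<open>a\<close> by the least element \<open>z\<close> of \<open>S\<close> with \<open>d udvd z\<close>: the terms that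
  belong to \<open>z\<close> make up \<open>B_star g S z\<close>. That \<open>z\<close> unitarily divides \<open>a\<close> is the point where closure
  under \<open>gcud\<close> enters: \<open>gcud z a\<close> lies in \<open>S\<close> and is again a unitary multiple of \<open>d\<close>, so by
  minimality it equals \<open>z\<close>.
\<close>

lemma sum_B_star_udvd:
  assumes fin: "finite S" and pos: "\<And>y. y \<in> S \<Longrightarrow> y > 0" and closed: "gcud_closed S"
    and a: "a \<in> S"
  shows "(\<Sum>z | z \<in> S \<and> z udvd a. B_star g S z) = g a"
proof -
  \<comment> \<open>the divisors over which \<open>B_star g S z\<close> sums\<close>
  define New where "New z = {d. d udvd z \<and> (\<forall>t\<in>S. t < z \<longrightarrow> \<not> d udvd t)}" for z
  have "(\<Union>z\<in>{z \<in> S. z udvd a}. New z) = {d. d udvd a}"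
  proof (intro equalityI subsetI)
    fix d assume "d \<in> {d. d udvd a}"
    then have da: "d udvd a" by simp
    define z where "z = (LEAST z. z \<in> S \<and> d udvd z)"
    have z: "z \<in> S" "d udvd z" 
      using LeastI[of "\<lambda>z. z \<in> S \<and> d udvd z" a] a da unfolding z_def by auto
    have least: "z \<le> t" if "t \<in> S" "d udvd t" for t
      unfolding z_def using that by (intro Least_le) auto
    have "gcud z a \<in> S" using closed z a by (auto simp: gcud_closed_def)
    moreover have "d udvd gcud z a" using z a da pos by (simp add: udvd_gcud_iff)
    ultimately have "z \<le> gcud z a" by (rule least)
    moreover have "gcud z a udvd z" "gcud z a udvd a"
      using z a pos gcud_udvd1 gcud_udvd2 by auto
    ultimately have "z udvd a" using udvd_imp_le le_antisym by metis
    then show "d \<in> (\<Union>z\<in>{z \<in> S. z udvd a}. New z)"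
      using z least by (fastforce simp: New_def)
  qed (auto simp: New_def intro: udvd_trans)
  moreover have "(\<Sum>d\<in>(\<Union>z\<in>{z \<in> S. z udvd a}. New z). unitary_conv g mu_star d) =
      (\<Sum>z | z \<in> S \<and> z udvd a. \<Sum>d\<in>New z. unitary_conv g mu_star d)"
  proof (rule sum.UNION_disjoint)
    show "\<forall>z\<in>{z \<in> S. z udvd a}. finite (New z)"
      using finite_udvd by (auto simp: New_def)
    show "\<forall>y\<in>{z \<in> S. z udvd a}. \<forall>z\<in>{z \<in> S. z udvd a}. y \<noteq> z \<longrightarrow> New y \<inter> New z = {}"
      by (auto simp: New_def dest: nat_neq_iff[THEN iffD1])
    show "finite {z \<in> S. z udvd a}" using fin by simp
  qed
  ultimately show ?thesis
    using sum_unitary_conv_mu_star[of a g] pos a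
    by (simp add: B_star_def New_def)
qed

section \<open>Hermitian forms and positive definiteness\<close>

lemma mat_adjoint_fixed_iff:
  fixes A :: "complex mat"
  assumes A: "A \<in> carrier_mat n n"
  shows "mat_adjoint A = A \<longleftrightarrow> (\<forall>i<n. \<forall>j<n. A $$ (j, i) = cnj (A $$ (i, j)))"
proof -
  have *: "mat_adjoint A \<in> carrier_mat n n"
      "\<And>i j. i < n \<Longrightarrow> j < n \<Longrightarrow> mat_adjoint A $$ (i, j) = cnj (A $$ (j, i))"
    using A by (auto simp: mat_adjoint_def mat_of_rows_def)
  show ?thesis
  proof
    assume adj: "mat_adjoint A = A"
    show "\<forall>i<n. \<forall>j<n. A $$ (j, i) = cnj (A $$ (i, j))"
    proof (intro allI impI)
      fix i j assume "i < n" "j < n"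
      then show "A $$ (j, i) = cnj (A $$ (i, j))" using *(2)[of j i] adj by metis
    qed
  next
    assume R: "\<forall>i<n. \<forall>j<n. A $$ (j, i) = cnj (A $$ (i, j))"
    show "mat_adjoint A = A"
    proof (rule eq_matI)
      fix i j assume "i < dim_row A" "j < dim_col A"
      then have "i < n" "j < n" using A by auto
      then show "mat_adjoint A $$ (i, j) = A $$ (i, j)" using *(2)[of i j] R by metis
    qed (use A *(1) in auto)
  qed
qed

lemma cscalar_prod_sum:
  fixes x y :: "complex vec"
  assumes "y \<in> carrier_vec n"
  shows "x \<bullet>c y = (\<Sum>i<n. x $ i * cnj (y $ i))"
  using assms by (simp add: scalar_prod_def lessThan_atLeast0)

lemma mult_mat_vec_sum:
  assumes "A \<in> carrier_mat n n" "x \<in> carrier_vec n" "i < n"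
  shows "(A *\<^sub>v x) $ i = (\<Sum>j<n. A $$ (i, j) * x $ j)"
  using assms by (simp add: scalar_prod_def lessThan_atLeast0)

lemma cscalar_prod_mult_sum:
  fixes x y :: "complex vec"
  assumes "A \<in> carrier_mat n n" "x \<in> carrier_vec n" "y \<in> carrier_vec n"
  shows "(A *\<^sub>v x) \<bullet>c y = (\<Sum>i<n. \<Sum>j<n. A $$ (i, j) * x $ j * cnj (y $ i))"
  unfolding cscalar_prod_sum[OF assms(3)]
  by (intro sum.cong[OF refl], subst mult_mat_vec_sum[OF assms(1,2)])
    (auto simp: sum_distrib_right)

lemma cscalar_prod_hermitian:
  fixes x y :: "complex vec"
  assumes A: "A \<in> carrier_mat n n" "mat_adjoint A = A"
    and x: "x \<in> carrier_vec n" and y: "y \<in> carrier_vec n"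
  shows "(A *\<^sub>v y) \<bullet>c x = cnj ((A *\<^sub>v x) \<bullet>c y)"
proof -
  have herm: "cnj (A $$ (j, i)) = A $$ (i, j)" if "i < n" "j < n" for i j
    using A that by (metis mat_adjoint_fixed_iff)
  have "(A *\<^sub>v y) \<bullet>c x = (\<Sum>i<n. \<Sum>j<n. A $$ (i, j) * y $ j * cnj (x $ i))"
    by (rule cscalar_prod_mult_sum[OF A(1) y x])
  also have "\<dots> = (\<Sum>i<n. \<Sum>j<n. cnj (A $$ (j, i) * x $ i * cnj (y $ j)))"
    by (intro sum.cong refl) (simp add: herm mult_ac)
  also have "\<dots> = (\<Sum>j<n. \<Sum>i<n. cnj (A $$ (j, i) * x $ i * cnj (y $ j)))"
    by (rule sum.swap)
  finally show ?thesis by (simp add: cscalar_prod_mult_sum[OF A(1) x y])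
qed

lemma cscalar_prod_self:
  fixes x :: "complex vec"
  assumes "x \<in> carrier_vec n"
  shows "x \<bullet>c x = of_real (\<Sum>i<n. (cmod (x $ i))\<^sup>2)"
  unfolding cscalar_prod_sum[OF assms] by (simp only: of_real_sum complex_norm_square)

lemma cscalar_prod_mult_bounded:
  assumes A: "A \<in> carrier_mat n n"
  obtains c :: real where "c > 0"
    "\<And>x. x \<in> carrier_vec n \<Longrightarrow> cmod ((A *\<^sub>v x) \<bullet>c x) \<le> c * Re (x \<bullet>c x)"
proof -
  define c where "c = (\<Sum>i<n. \<Sum>j<n. cmod (A $$ (i, j)))"
  have c: "cmod ((A *\<^sub>v x) \<bullet>c x) \<le> c * Re (x \<bullet>c x)" if x: "x \<in> carrier_vec n" for x
  proof -
    let ?N = "\<Sum>i<n. (cmod (x $ i))\<^sup>2"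
    have sq: "(cmod (x $ i))\<^sup>2 \<le> ?N" if "i < n" for i
      using that by (intro member_le_sum) auto
    have "cmod ((A *\<^sub>v x) \<bullet>c x) \<le> (\<Sum>i<n. \<Sum>j<n. cmod (A $$ (i, j) * x $ j * cnj (x $ i)))"
      unfolding cscalar_prod_mult_sum[OF A x x] by (intro order.trans[OF norm_sum] sum_mono norm_sum)
    also have "\<dots> \<le> (\<Sum>i<n. \<Sum>j<n. cmod (A $$ (i, j)) * ?N)"
    proof (intro sum_mono)
      fix i j assume "i \<in> {..<n}" "j \<in> {..<n}"
      have "2 * (cmod (x $ j) * cmod (x $ i)) \<le> (cmod (x $ j))\<^sup>2 + (cmod (x $ i))\<^sup>2"
        using sum_squares_bound[of "cmod (x $ j)" "cmod (x $ i)"] by simp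
      also have "\<dots> \<le> 2 * ?N" using sq[of i] sq[of j] \<open>i \<in> _\<close> \<open>j \<in> _\<close> by simp
      finally show "cmod (A $$ (i, j) * x $ j * cnj (x $ i)) \<le> cmod (A $$ (i, j)) * ?N"
        by (simp add: norm_mult mult.assoc mult_left_mono)
    qed
    also have "\<dots> = c * ?N" by (simp add: c_def sum_distrib_right)
    finally show ?thesis by (simp add: cscalar_prod_self[OF x])
  qed
  have "c * Re (x \<bullet>c x) \<le> (c + 1) * Re (x \<bullet>c x)" if "x \<in> carrier_vec n" for x :: "complex vec"
    by (rule mult_right_mono) (auto simp: cscalar_prod_self[OF that] sum_nonneg)
  moreover have "c + 1 > 0" unfolding c_def by (intro add_nonneg_pos sum_nonneg) auto
  ultimately show thesis using that[of "c + 1"] c by force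
qed

lemma injective_mat_inverse:
  fixes A :: "complex mat"
  assumes A: "A \<in> carrier_mat n n"
    and inj: "\<And>v. v \<in> carrier_vec n \<Longrightarrow> A *\<^sub>v v = 0\<^sub>v n \<Longrightarrow> v = 0\<^sub>v n"
  obtains B where "B \<in> carrier_mat n n" "A * B = 1\<^sub>m n"
proof -
  have "det A \<noteq> 0" using inj det_0_iff_vec_prod_zero_field[OF A] by blast
  then have "A \<in> Units (ring_mat TYPE(complex) n ())"
    by (rule det_non_zero_imp_unit[OF A])
  then show thesis using that by (auto simp: Units_def ring_mat_def)
qed

lemma shift_mult_mat_vec:
  fixes x :: "complex vec"
  assumes A: "A \<in> carrier_mat n n" and x: "x \<in> carrier_vec n"
  shows "(A + a \<cdot>\<^sub>m 1\<^sub>m n) *\<^sub>v x = A *\<^sub>v x + a \<cdot>\<^sub>v x"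
proof -
  have "(a \<cdot>\<^sub>m 1\<^sub>m n) *\<^sub>v x = a \<cdot>\<^sub>v x"
    using x by (intro eq_vecI) auto
  then show ?thesis using A x by (simp add: add_mult_distrib_mat_vec[of _ n n])
qed

lemma cscalar_prod_shift:
  fixes x y :: "complex vec"
  assumes A: "A \<in> carrier_mat n n" and x: "x \<in> carrier_vec n" and y: "y \<in> carrier_vec n"
  shows "((A + of_real t \<cdot>\<^sub>m 1\<^sub>m n) *\<^sub>v x) \<bullet>c y = (A *\<^sub>v x) \<bullet>c y + of_real t * (x \<bullet>c y)"
  using A x y by (simp add: shift_mult_mat_vec add_scalar_prod_distrib[of _ n])

text \<open>
  Let \<open>M u = x\<close>. Semidefiniteness applied to \<open>x - r u\<close> with real \<open>r\<close> gives
  \<open>0 \<le> \<langle>M x, x\<rangle> - 2 r \<langle>x, x\<rangle> + r\<^sup>2 \<langle>x, u\<rangle>\<close>, and \<open>\<langle>x, u\<rangle> \<le> c \<langle>x, x\<rangle>\<close> because the form of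
  \<open>M\<close>'s inverse is bounded. The choice \<open>r = 1 / c\<close> leaves \<open>\<langle>x, x\<rangle> / c \<le> \<langle>M x, x\<rangle>\<close>.
\<close>

lemma coercive_if_semidefinite_injective:
  fixes M :: "complex mat"
  assumes M: "M \<in> carrier_mat n n" "mat_adjoint M = M"
    and psd: "\<And>x. x \<in> carrier_vec n \<Longrightarrow> 0 \<le> Re ((M *\<^sub>v x) \<bullet>c x)"
    and inj: "\<And>v. v \<in> carrier_vec n \<Longrightarrow> M *\<^sub>v v = 0\<^sub>v n \<Longrightarrow> v = 0\<^sub>v n"
  obtains c where "c > 0"
    "\<And>x. x \<in> carrier_vec n \<Longrightarrow> c * Re (x \<bullet>c x) \<le> Re ((M *\<^sub>v x) \<bullet>c x)"
proof -
  obtain N where N: "N \<in> carrier_mat n n" "M * N = 1\<^sub>m n"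
    using injective_mat_inverse[OF M(1) inj] by blast
  obtain c where c: "c > 0"
    "\<And>x. x \<in> carrier_vec n \<Longrightarrow> cmod ((N *\<^sub>v x) \<bullet>c x) \<le> c * Re (x \<bullet>c x)"
    using cscalar_prod_mult_bounded[OF N(1)] by blast
  have "1 / c * Re (x \<bullet>c x) \<le> Re ((M *\<^sub>v x) \<bullet>c x)" if x: "x \<in> carrier_vec n" for x
  proof -
    define u where "u = N *\<^sub>v x"
    define r :: complex where "r = of_real (1 / c)"
    have u: "u \<in> carrier_vec n" using N x by (simp add: u_def)
    have Mu: "M *\<^sub>v u = x"
      using N M x by (simp add: u_def flip: assoc_mult_mat_vec[of _ n n])
    have ux: "Re (x \<bullet>c u) \<le> c * Re (x \<bullet>c x)"
    proof -
      have "x \<bullet>c u = cnj (u \<bullet>c x)"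
        using x u by (simp add: cscalar_prod_sum[of _ n] mult.commute)
      then show ?thesis using c(2)[OF x] complex_Re_le_cmod[of "u \<bullet>c x"]
        by (simp add: u_def)
    qed
    have "(M *\<^sub>v x) \<bullet>c u = cnj (x \<bullet>c x)"
      using cscalar_prod_hermitian[OF M u x] Mu by simp
    then have Mxu: "(M *\<^sub>v x) \<bullet>c u = x \<bullet>c x" by (simp add: cscalar_prod_self[OF x])
    have "M *\<^sub>v (x - r \<cdot>\<^sub>v u) = M *\<^sub>v x - r \<cdot>\<^sub>v x"
      using M x u Mu by (simp add: mult_minus_distrib_mat_vec[of _ n n] mult_mat_vec[of _ n n])
    moreover have "conjugate (x - r \<cdot>\<^sub>v u) = conjugate x - r \<cdot>\<^sub>v conjugate u"
      using x u by (intro eq_vecI) (auto simp: r_def)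
    ultimately have "(M *\<^sub>v (x - r \<cdot>\<^sub>v u)) \<bullet>c (x - r \<cdot>\<^sub>v u) =
        (M *\<^sub>v x) \<bullet>c x - r * ((M *\<^sub>v x) \<bullet>c u) - r * (x \<bullet>c x) + r * r * (x \<bullet>c u)"
      using M x u
      by (simp add: minus_scalar_prod_distrib[of _ n] scalar_prod_minus_distrib[of _ n] algebra_simps)
    then have "Re ((M *\<^sub>v (x - r \<cdot>\<^sub>v u)) \<bullet>c (x - r \<cdot>\<^sub>v u)) =
        Re ((M *\<^sub>v x) \<bullet>c x) - 2 / c * Re (x \<bullet>c x) + 1 / (c * c) * Re (x \<bullet>c u)"
      unfolding Mxu by (simp add: r_def)
    then have "0 \<le> Re ((M *\<^sub>v x) \<bullet>c x) - 2 / c * Re (x \<bullet>c x) + 1 / (c * c) * Re (x \<bullet>c u)"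
      using psd[of "x - r \<cdot>\<^sub>v u"] x u by simp
    moreover have "1 / (c * c) * Re (x \<bullet>c u) \<le> 1 / (c * c) * (c * Re (x \<bullet>c x))"
      using ux c(1) by (intro mult_left_mono) auto
    ultimately show ?thesis using c(1) by simp
  qed
  then show thesis using that[of "1 / c"] c(1) by simp
qed

text \<open>
  Let \<open>t\<close> be the least nonnegative number such that \<open>A + t I\<close> is positive semidefinite. A kernel
  vector of \<open>A + t I\<close> would be an eigenvector of \<open>A\<close> for the eigenvalue \<open>- t \<le> 0\<close>, so \<open>A + t I\<close> is
  injective and hence bounded below by a positive multiple of the identity. If \<open>t\<close> were positive,
  it could therefore be decreased; so \<open>t = 0\<close>, and \<open>A\<close> itself is bounded below.
\<close>

lemma positive_form_if_positive_definite:
  fixes A :: "complex mat"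
  assumes A: "A \<in> carrier_mat n n" and pd: "positive_definite A"
    and v: "v \<in> carrier_vec n" "v \<noteq> 0\<^sub>v n"
  shows "0 < (A *\<^sub>v v) \<bullet>c v"
proof -
  have herm: "mat_adjoint A = A" and eig: "\<And>k. eigenvalue A k \<Longrightarrow> 0 < k"
    using pd unfolding positive_definite_def by blast+
  define M where "M t = A + of_real t \<cdot>\<^sub>m 1\<^sub>m n" for t :: real
  define q where "q x = Re ((A *\<^sub>v x) \<bullet>c x)" for x
  define N where "N x = Re (x \<bullet>c x)" for x :: "complex vec"
  have M: "M t \<in> carrier_mat n n" for t using A by (simp add: M_def)
  have Mherm: "mat_adjoint (M t) = M t" for t
  proof -
    have "cnj (A $$ (i, j)) = A $$ (j, i)" if "i < n" "j < n" for i j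
      using herm that unfolding mat_adjoint_fixed_iff[OF A] by metis
    then show ?thesis
      unfolding mat_adjoint_fixed_iff[OF M] using A by (simp add: M_def)
  qed
  have Mq: "Re ((M t *\<^sub>v x) \<bullet>c x) = q x + t * N x" if "x \<in> carrier_vec n" for t x
    using cscalar_prod_shift[OF A that that] by (simp add: M_def q_def N_def)
  have N0: "N x \<ge> 0" if "x \<in> carrier_vec n" for x
    using that by (simp add: N_def cscalar_prod_self[OF that] sum_nonneg)
  have Minj: "x = 0\<^sub>v n" if "t \<ge> 0" "x \<in> carrier_vec n" "M t *\<^sub>v x = 0\<^sub>v n" for t x
  proof (rule ccontr)
    assume "x \<noteq> 0\<^sub>v n"
    moreover have "A *\<^sub>v x = (- of_real t) \<cdot>\<^sub>v x"
    proof -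
      have "A *\<^sub>v x + of_real t \<cdot>\<^sub>v x = 0\<^sub>v n"
        using that shift_mult_mat_vec[OF A, of x "of_real t"] by (simp add: M_def)
      then show ?thesis using that A by (auto simp: vec_eq_iff eq_neg_iff_add_eq_0)
    qed
    ultimately have "eigenvalue A (- of_real t)"
      using that A by (auto simp: eigenvalue_def eigenvector_def)
    then show False using eig[of "- of_real t"] that by (auto simp: less_complex_def)
  qed
  \<comment> \<open>\<open>q x + t * N x\<close> is the form of \<open>A + t I\<close>, so \<open>T\<close> collects the semidefinite shifts.\<close>
  define T where "T = {t. t \<ge> 0 \<and> (\<forall>x\<in>carrier_vec n. 0 \<le> q x + t * N x)}"
  obtain b where b: "b > 0" "\<And>x. x \<in> carrier_vec n \<Longrightarrow> cmod ((A *\<^sub>v x) \<bullet>c x) \<le> b * N x"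
    using cscalar_prod_mult_bounded[OF A] unfolding N_def by blast
  have "0 \<le> q x + b * N x" if "x \<in> carrier_vec n" for x
    using b(2)[OF that] abs_Re_le_cmod[of "(A *\<^sub>v x) \<bullet>c x"] unfolding q_def by linarith
  then have "b \<in> T" using b(1) by (simp add: T_def)
  then have ne: "T \<noteq> {}" by auto
  have bdd: "bdd_below T" unfolding T_def by (intro bdd_belowI[of _ 0]) auto
  define t where "t = Inf T"
  have t0: "t \<ge> 0" unfolding t_def using ne by (intro cInf_greatest) (auto simp: T_def)
  have psd: "0 \<le> q x + t * N x" if x: "x \<in> carrier_vec n" for x
  proof (cases "N x = 0")
    case True
    then show ?thesis using \<open>b \<in> T\<close> x by (force simp: T_def)
  next
    case False
    then have "N x > 0" using N0[OF x] by simp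
    moreover from this have "- q x / N x \<le> t"
      unfolding t_def using ne x by (intro cInf_greatest) (auto simp: T_def field_simps)
    ultimately show ?thesis by (simp add: field_simps)
  qed
  obtain c where c: "c > 0"
    "\<And>x. x \<in> carrier_vec n \<Longrightarrow> c * N x \<le> q x + t * N x"
    using coercive_if_semidefinite_injective[OF M[of t] Mherm[of t]] psd Minj[OF t0] Mq
    unfolding N_def by metis
  have "t = 0"
  proof (rule ccontr)
    assume "t \<noteq> 0"
    \<comment> \<open>The shift by \<open>t - c\<close> is still semidefinite; \<open>max\<close> keeps the shift nonnegative.\<close>
    define s where "s = max 0 (t - c)"
    have "0 \<le> q x + s * N x" if x: "x \<in> carrier_vec n" for x
    proof -
      have "(t - c) * N x \<le> s * N x" using N0[OF x] by (intro mult_right_mono) (auto simp: s_def)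
      then show ?thesis using c(2)[OF x] by (simp add: algebra_simps)
    qed
    then have "s \<in> T" by (auto simp: T_def s_def)
    then have "t \<le> s" unfolding t_def by (intro cInf_lower bdd)
    then show False using \<open>t \<noteq> 0\<close> t0 c(1) by (auto simp: s_def)
  qed
  have "N v > 0"
    using conjugate_square_greater_0_vec[OF v(1)] v(2) by (simp add: N_def less_complex_def)
  then have "0 < c * N v" using c(1) by simp
  then have "q v > 0" using c(2)[OF v(1)] \<open>t = 0\<close> by simp
  moreover have "Im ((A *\<^sub>v v) \<bullet>c v) = 0"
    using cscalar_prod_hermitian[OF A herm v(1) v(1)] by (simp add: complex_eq_iff)
  ultimately show ?thesis by (simp add: q_def less_complex_def)
qed

text \<open>
  The hypothesis says \<open>A = C\<^sup>* D C\<close>, so the Hermitian form of \<open>A\<close> at \<open>v\<close> is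
  \<open>\<Sum>k. D k * \<bar>(C v) $ k\<bar>\<^sup>2\<close>. Since \<open>C\<close> is invertible, \<open>C v\<close> takes every value; unit vectors pick
  out the individual \<open>D k\<close>. The \<open>D k\<close> are arbitrary complex numbers here: either side of the
  equivalence forces them to be real.
\<close>

lemma positive_definite_congruent_diagonal_iff:
  fixes A C :: "complex mat" and D :: "nat \<Rightarrow> complex"
  assumes A: "A \<in> carrier_mat n n" and C: "C \<in> carrier_mat n n"
    and inj: "\<And>v. v \<in> carrier_vec n \<Longrightarrow> C *\<^sub>v v = 0\<^sub>v n \<Longrightarrow> v = 0\<^sub>v n"
    and AC: "\<And>i j. i < n \<Longrightarrow> j < n \<Longrightarrow>
      A $$ (i, j) = (\<Sum>k<n. cnj (C $$ (k, i)) * D k * C $$ (k, j))"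
  shows "positive_definite A \<longleftrightarrow> (\<forall>k<n. 0 < D k)"
proof -
  have form: "(A *\<^sub>v v) \<bullet>c v = (\<Sum>k<n. D k * of_real ((cmod ((C *\<^sub>v v) $ k))\<^sup>2))"
    if v: "v \<in> carrier_vec n" for v
  proof -
    have "(A *\<^sub>v v) \<bullet>c v =
        (\<Sum>i<n. \<Sum>j<n. \<Sum>k<n. D k * (C $$ (k, j) * v $ j) * cnj (C $$ (k, i) * v $ i))"
      unfolding cscalar_prod_mult_sum[OF A v v]
      by (intro sum.cong refl) (simp add: AC sum_distrib_left sum_distrib_right mult_ac)
    also have "\<dots> = (\<Sum>i<n. \<Sum>k<n. \<Sum>j<n. D k * (C $$ (k, j) * v $ j) * cnj (C $$ (k, i) * v $ i))"
      by (intro sum.cong refl sum.swap)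
    also have "\<dots> = (\<Sum>k<n. \<Sum>i<n. \<Sum>j<n. D k * (C $$ (k, j) * v $ j) * cnj (C $$ (k, i) * v $ i))"
      by (rule sum.swap)
    also have "\<dots> = (\<Sum>k<n. D k * (cnj ((C *\<^sub>v v) $ k) * (C *\<^sub>v v) $ k))"
    proof (intro sum.cong refl)
      fix k assume "k \<in> {..<n}"
      then have "(C *\<^sub>v v) $ k = (\<Sum>j<n. C $$ (k, j) * v $ j)"
        by (intro mult_mat_vec_sum[OF C v]) simp
      then show "(\<Sum>i<n. \<Sum>j<n. D k * (C $$ (k, j) * v $ j) * cnj (C $$ (k, i) * v $ i)) =
          D k * (cnj ((C *\<^sub>v v) $ k) * (C *\<^sub>v v) $ k)"
        by (simp add: sum_product sum_distrib_left mult_ac del: index_mult_mat_vec)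
    qed
    finally show ?thesis by (simp only: complex_norm_square mult.commute)
  qed
  show ?thesis
  proof
    assume pd: "positive_definite A"
    show "\<forall>k<n. 0 < D k"
    proof (intro allI impI)
      fix k assume k: "k < n"
      obtain N where N: "N \<in> carrier_mat n n" "C * N = 1\<^sub>m n"
        using injective_mat_inverse[OF C inj] by blast
      define v where "v = N *\<^sub>v unit_vec n k"
      have v: "v \<in> carrier_vec n" using N by (simp add: v_def)
      have Cv: "C *\<^sub>v v = unit_vec n k"
        using N C by (simp add: v_def flip: assoc_mult_mat_vec[of _ n n])
      have "v \<noteq> 0\<^sub>v n"
      proof
        assume "v = 0\<^sub>v n"
        then have "(C *\<^sub>v v) $ k = 0" using k unfolding mult_mat_vec_sum[OF C v k] by simp
        then show False using k by (simp add: Cv)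
      qed
      then have "0 < (A *\<^sub>v v) \<bullet>c v" by (rule positive_form_if_positive_definite[OF A pd v])
      also have "(A *\<^sub>v v) \<bullet>c v = (\<Sum>l<n. if l = k then D l else 0)"
        unfolding form[OF v] Cv using k by (intro sum.cong) auto
      finally show "0 < D k" using k by simp
    qed
  next
    assume D: "\<forall>k<n. 0 < D k"
    have "mat_adjoint A = A"
    proof -
      have "cnj (D k) = D k" if "k < n" for k
        using D that by (simp add: less_complex_def complex_eq_iff)
      then show ?thesis
        unfolding mat_adjoint_fixed_iff[OF A] by (auto simp: AC mult_ac intro!: sum.cong)
    qed
    moreover have "0 < e" if "eigenvalue A e" for e
    proof -
      obtain v where v: "v \<in> carrier_vec n" "v \<noteq> 0\<^sub>v n" "A *\<^sub>v v = e \<cdot>\<^sub>v v"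
        using \<open>eigenvalue A e\<close> A by (auto simp: eigenvalue_def eigenvector_def)
      define u where "u = C *\<^sub>v v"
      have "u \<in> carrier_vec n" "u \<noteq> 0\<^sub>v n" using inj v C by (auto simp: u_def)
      then obtain k where k: "k < n" "u $ k \<noteq> 0" by (auto simp: vec_eq_iff)
      have "0 < (\<Sum>k<n. D k * of_real ((cmod (u $ k))\<^sup>2))"
      proof (rule sum_pos2[of _ k])
        show "0 < D k * of_real ((cmod (u $ k))\<^sup>2)"
          using D k by (auto simp: less_complex_def)
        show "0 \<le> D i * of_real ((cmod (u $ i))\<^sup>2)" if "i \<in> {..<n}" for i
          using D that by (auto simp: less_complex_def less_eq_complex_def)
      qed (use k in auto)
      also have "\<dots> = e * (v \<bullet>c v)"
        using form[OF v(1)] v by (simp add: u_def)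
      finally have "0 < e * (v \<bullet>c v)" .
      moreover have "0 < v \<bullet>c v" using conjugate_square_greater_0_vec[OF v(1)] v(2) by simp
      ultimately show ?thesis
        by (auto simp: less_complex_def zero_less_mult_iff)
    qed
    ultimately show "positive_definite A" using A by (simp add: positive_definite_def)
  qed
qed

section \<open>Factorization of the matrix of least common unitary multiples\<close>

lemma completely_multiplicative_lcum:
  assumes f: "completely_multiplicative f" "\<And>m. m > 0 \<Longrightarrow> f m \<noteq> 0" and ab: "a > 0" "b > 0"
  shows "f (lcum a b) = f a * f b * (1 / f (gcud a b))"
proof -
  have g: "gcud a b > 0" using gcud_udvd1[OF ab] udvd_pos by blast
  have *: "lcum a b * gcud a b = a * b"
    using gcud_dvd[OF ab] by (simp add: lcum_def)
  then have "lcum a b > 0" using ab by (metis mult_is_0 neq0_conv)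
  then have "f (lcum a b) * f (gcud a b) = f a * f b"
    using f(1) ab g * unfolding completely_multiplicative_def by metis
  then show ?thesis using f(2)[OF g] by (simp add: field_simps)
qed

lemma lcum_self: "a > 0 \<Longrightarrow> lcum a a = a"
proof -
  assume a: "a > 0"
  have "gcud a a = a"
    using udvd_gcud_iff[OF a a, of a] udvd_refl[OF a] gcud_udvd1[OF a a] udvd_imp_le
    by (metis le_antisym)
  then show ?thesis using a by (simp add: lcum_def)
qed

theorem theorem5p6:
  fixes n :: nat and x :: "nat \<Rightarrow> nat" and S :: "nat set" and f :: "nat \<Rightarrow> complex"
  assumes "S = x ` {..<n}"
    and "inj_on x {..<n}"
    and "\<And>i. i < n \<Longrightarrow> x i > 0"
    and "gcud_closed S"
    and "completely_multiplicative f"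
    and "\<And>m. m > 0 \<Longrightarrow> f m \<noteq> 0"
  shows "positive_definite (lcum_mat f n x) \<longleftrightarrow>
    (\<forall>i<n. B_star (\<lambda>m. 1 / f m) S (x i) > 0)"
proof -
  note S = assms(1) and inj = assms(2) and pos = assms(3) and closed = assms(4)
    and cm = assms(5) and nz = assms(6)
  define A where "A = lcum_mat f n x"
  define B where "B k = B_star (\<lambda>m. 1 / f m) S (x k)" for k
  define C where "C = mat n n (\<lambda>(k, j). if x k udvd x j then f (x j) else 0)"
  have A: "A \<in> carrier_mat n n" by (simp add: A_def lcum_mat_def)
  have C: "C \<in> carrier_mat n n" by (simp add: C_def)
  have sum_B: "(\<Sum>k<n. if x k udvd a then B k else 0) = 1 / f a" if "a \<in> S" for a
  proof -
    have "(\<Sum>k<n. if x k udvd a then B k else 0) =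
        (\<Sum>z\<in>S. if z udvd a then B_star (\<lambda>m. 1 / f m) S z else 0)"
      unfolding S B_def by (subst sum.reindex[OF inj]) simp
    also have "\<dots> = (\<Sum>z | z \<in> S \<and> z udvd a. B_star (\<lambda>m. 1 / f m) S z)"
      by (subst sum.inter_filter[symmetric]) (simp_all add: S)
    also have "\<dots> = 1 / f a"
      using pos closed that by (intro sum_B_star_udvd) (auto simp: S)
    finally show ?thesis .
  qed
  have entry: "A $$ (i, j) = (\<Sum>k<n. (if x k udvd x i then f (x i) else 0) * B k *
      (if x k udvd x j then f (x j) else 0))" if "i < n" "j < n" for i j
  proof -
    have "gcud (x i) (x j) \<in> S" using closed that by (auto simp: gcud_closed_def S)
    then have "A $$ (i, j) = f (x i) * f (x j) *
        (\<Sum>k<n. if x k udvd gcud (x i) (x j) then B k else 0)"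
      using that completely_multiplicative_lcum[OF cm nz pos pos, of i j]
      by (simp add: A_def lcum_mat_def sum_B)
    then show ?thesis
      unfolding udvd_gcud_iff[OF pos[OF that(1)] pos[OF that(2)]] sum_distrib_left
      by (simp, intro sum.cong) auto
  qed
  \<comment> \<open>\<open>C\<close> is triangular when the indices are sorted by \<open>x\<close>: its row at the nonzero coordinate of
    \<open>v\<close> with the largest \<open>x i\<close> meets no other nonzero coordinate.\<close>
  have inj_C: "v = 0\<^sub>v n" if v: "v \<in> carrier_vec n" "C *\<^sub>v v = 0\<^sub>v n" for v
  proof (rule ccontr)
    assume "v \<noteq> 0\<^sub>v n"
    define P where "P = {i. i < n \<and> v $ i \<noteq> 0}"
    have "finite (x ` P)" "x ` P \<noteq> {}"
      using \<open>v \<noteq> 0\<^sub>v n\<close> v(1) by (auto simp: P_def vec_eq_iff)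
    then have "Max (x ` P) \<in> x ` P" and max: "\<And>j. j \<in> P \<Longrightarrow> x j \<le> Max (x ` P)"
      by (auto intro: Max_in)
    then obtain i where i: "i \<in> P" "\<And>j. j \<in> P \<Longrightarrow> x j \<le> x i" by auto
    then have "i < n" "v $ i \<noteq> 0" by (auto simp: P_def)
    have "(C *\<^sub>v v) $ i = (\<Sum>j<n. C $$ (i, j) * v $ j)"
      by (rule mult_mat_vec_sum[OF C v(1) \<open>i < n\<close>])
    also have "\<dots> = (\<Sum>j<n. if j = i then f (x i) * v $ i else 0)"
    proof (intro sum.cong refl)
      fix j assume j: "j \<in> {..<n}"
      show "C $$ (i, j) * v $ j = (if j = i then f (x i) * v $ i else 0)"
      proof (cases "j = i")
        case True
        then show ?thesis using \<open>i < n\<close> pos by (simp add: C_def udvd_refl)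
      next
        case False
        have "v $ j = 0" if "x i udvd x j"
        proof (rule ccontr)
          assume "v $ j \<noteq> 0"
          then have "x j \<le> x i" using i(2) j by (simp add: P_def)
          then have "x j = x i" using udvd_imp_le[OF that] by simp
          then show False using False inj j \<open>i < n\<close> by (auto dest: inj_onD)
        qed
        then show ?thesis using False j \<open>i < n\<close> by (auto simp: C_def)
      qed
    qed
    also have "\<dots> = f (x i) * v $ i" using \<open>i < n\<close> by simp
    finally show False
      using v(2) \<open>i < n\<close> \<open>v $ i \<noteq> 0\<close> nz[OF pos] by simp
  qed
  \<comment> \<open>\<open>entry\<close> factors \<open>A\<close> with the transpose of \<open>C\<close>; it is the adjoint once \<open>f\<close> is real on \<open>S\<close>.\<close>
  have equiv: "positive_definite A \<longleftrightarrow> (\<forall>k<n. 0 < B k)"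
    if real: "\<And>i. i < n \<Longrightarrow> cnj (f (x i)) = f (x i)"
  proof (rule positive_definite_congruent_diagonal_iff[OF A C inj_C])
    fix i j assume "i < n" "j < n"
    then show "A $$ (i, j) = (\<Sum>k<n. cnj (C $$ (k, i)) * B k * C $$ (k, j))"
      unfolding entry[OF \<open>i < n\<close> \<open>j < n\<close>] by (intro sum.cong refl) (simp add: C_def real)
  qed
  \<comment> \<open>The numbers \<open>f (x i)\<close> are the diagonal entries of \<open>A\<close>, since \<open>lcum a a = a\<close>.\<close>
  have "cnj (f (x i)) = f (x i)" if "positive_definite A" "i < n" for i
  proof -
    have "mat_adjoint A = A" using that(1) by (simp add: positive_definite_def)
    then have "cnj (A $$ (i, i)) = A $$ (i, i)"
      using that(2) unfolding mat_adjoint_fixed_iff[OF A] by metis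
    then show ?thesis
      using that(2) pos by (simp add: A_def lcum_mat_def lcum_self)
  qed
  moreover have "cnj (f (x i)) = f (x i)" if "\<forall>k<n. 0 < B k" "i < n" for i
  proof -
    have "cnj (B k) = B k" if "k < n" for k
      using \<open>\<forall>k<n. 0 < B k\<close> that by (simp add: less_complex_def complex_eq_iff)
    then have "cnj (\<Sum>k<n. if x k udvd x i then B k else 0) =
        (\<Sum>k<n. if x k udvd x i then B k else 0)"
      unfolding cnj_sum by (intro sum.cong) auto
    then have "cnj (1 / f (x i)) = 1 / f (x i)"
      using sum_B[of "x i"] that(2) by (simp add: S)
    then show ?thesis by simp
  qed
  ultimately show ?thesis using equiv unfolding A_def B_def by blast
qed

end
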